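(* Consider the following nondeterministic program on states $(x,y)\in\mathbb{Z}^2$. Initially $(x,y)$ is an arbitrary element of $\mathbb{Z}^2$ supplied by the user. While $x>0$ and $y>0$, the user chooses a value $\mathrm{control}\in\{1,2\}$ and the following simultaneous assignment is executed (the right-hand sides use the old values): \begin{itemize} \item if $\mathrm{control}=1$: $(x,y)=(x-1,\,x)$; \item if $\mathrm{control}=2$: $(x,y)=(y-2,\,x+1)$. \end{itemize} Then every computation of this program is finite.
   Context: A program is a tuple $(S,I,R)$ where $S$ is a set of states, $I\subseteq S$ is the set of possible initial states, and $R\subseteq S\times S$ is the set of pairs $(s,t)$ such that $s$ satisfies the condition of the while loop and some choice of instruction takes $s$ to $t$ in one iteration of the loop body. A computation is a finite or infinite sequence of states $s_1,s_2,\ldots$ with $s_1\in I$, with $R(s_i,s_{i+1})$ for all consecutive terms, and such that if the sequence is finite with last state $s$ then there is no $t$ with $R(s,t)$. Here $S=I=\mathbb{Z}^2$. *)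

theory Defs
  imports Main
begin

type_synonym 's program = "'s set \<times> 's set \<times> ('s \<times> 's) set"

fun is_program :: "'s program \<Rightarrow> bool" where
  "is_program (S, I, R) \<longleftrightarrow> I \<subseteq> S \<and> R \<subseteq> S \<times> S"

text \<open>Finite or infinite sequences; positions are counted from 0, so the paper's
  \<open>s\<^sub>1\<close> is \<open>xs ! 0\<close> or \<open>f 0\<close>.\<close>

datatype 's seq = Fin "'s list" | Inf "nat \<Rightarrow> 's"

fun finite_seq :: "'s seq \<Rightarrow> bool" where
  "finite_seq (Fin xs) \<longleftrightarrow> True"
| "finite_seq (Inf f) \<longleftrightarrow> False"

fun computation :: "'s program \<Rightarrow> 's seq \<Rightarrow> bool" where
  "computation (S, I, R) (Fin xs) \<longleftrightarrow>
     xs \<noteq> [] \<and> set xs \<subseteq> S \<and> xs ! 0 \<in> I \<and>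
     (\<forall>i. Suc i < length xs \<longrightarrow> (xs ! i, xs ! Suc i) \<in> R) \<and>
     \<not> (\<exists>t. (last xs, t) \<in> R)"
| "computation (S, I, R) (Inf f) \<longleftrightarrow>
     range f \<subseteq> S \<and> f 0 \<in> I \<and> (\<forall>i. (f i, f (Suc i)) \<in> R)"

fun loop_guard :: "int \<times> int \<Rightarrow> bool" where
  "loop_guard (x, y) \<longleftrightarrow> x > 0 \<and> y > 0"

fun loop_body :: "nat \<Rightarrow> int \<times> int \<Rightarrow> int \<times> int" where
  "loop_body control (x, y) = (if control = 1 then (x - 1, x) else (y - 2, x + 1))"

definition control_program :: "(int \<times> int) program" where
  "control_program =
     (UNIV, UNIV, {(s, t). loop_guard s \<and> (\<exists>control\<in>{1, 2}. t = loop_body control s)})"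

lemma is_program_control_program: "is_program control_program"
  by (simp add: control_program_def)

end

theory Submission
  imports Defs
begin

text \<open>The second assignment always lowers \<open>x + y\<close>. The first one may raise it, but it leads
  to \<open>y = x + 1\<close>, and the set \<open>y \<in> {x + 1, x + 2}\<close> is preserved by both assignments; inside it
  the first assignment lowers \<open>x + y\<close> as well. Hence membership in this set followed by \<open>x + y\<close>
  is a lexicographic ranking.\<close>

definition step_rank :: "((int \<times> int) \<times> (int \<times> int)) set" where
  "step_rank = measures [\<lambda>(x, y). if y = x + 1 \<or> y = x + 2 then 0 else 1, \<lambda>(x, y). nat (x + y)]"

lemma wf_step_rank: "wf step_rank"
  by (simp add: step_rank_def)

text \<open>On the lines \<open>y = x + 1\<close> and \<open>y = x + 2\<close>, control 1 gives the
  sum \<open>2 * x - 1 < x + y\<close>, while control 2 exchanges the two lines. The guard makes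
  \<open>x + y\<close> positive, so a smaller sum also has a smaller \<open>nat\<close>.\<close>

lemma loop_body_step_rank:
  assumes "loop_guard s"
  shows "(loop_body control s, s) \<in> step_rank"
  using assms by (cases s) (auto simp: step_rank_def)

theorem theorem9p1:
  "\<forall>c. computation control_program c \<longrightarrow> finite_seq c"
proof (intro allI impI)
  fix c
  assume c: "computation control_program c"
  show "finite_seq c"
  proof (cases c)
    case (Fin xs)
    then show ?thesis by simp
  next
    case (Inf f)
    with c have "loop_guard (f i) \<and> (\<exists>control\<in>{1, 2}. f (Suc i) = loop_body control (f i))" for i
      by (simp add: control_program_def)
    then have "(f (Suc i), f i) \<in> step_rank" for i
      by (metis loop_body_step_rank)
    \<comment> \<open>The goal reduces to \<open>False\<close>: \<open>f\<close> would be an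
      infinite descending chain of \<open>step_rank\<close>, against its well-foundedness.\<close>
    then show ?thesis
      using wf_step_rank by (auto simp: wf_iff_no_infinite_down_chain)
  qed
qed

end
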